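(* Let $\mathbf C$ be a category with a functor $|\cdot|:\mathbf C\to\mathbf{Set}$, assume $\mathbf C$ has binary products, let $F:\mathbf C\to\mathbf C$ be a functor, let $\lambda:\Psi\to\Psi F$ be an indexed morphism with $\lambda_X(\equiv_X)=\,\equiv_{FX}$ for every object $X$, and assume the equality functor $\mathrm{Eq}:\mathbf C\to\int\Psi$ has a left adjoint $\mathrm{Qu}$. Let $\alpha:X\to FX$ be an $F$-coalgebra and let $R\in\Psi X$ satisfy $R\subseteq\alpha^*(\lambda_X R)$. Then there exist an $F$-coalgebra $(Y,\beta)$ and a coalgebra homomorphism $f:(X,\alpha)\to(Y,\beta)$ such that $R\subseteq f^*(\equiv_Y)$. Moreover, if the unit of $\mathrm{Qu}\dashv\mathrm{Eq}$ is Cartesian, then $R=f^*(\equiv_Y)$.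
   Context: Binary products in $\mathbf C$ are written $X\otimes Y$, with projections $\pi_1^X,\pi_2^X:X\otimes X\to X$; for $g:X\to Y$, $g\otimes g$ is the induced morphism. $\Psi X$ is the poset (under $\subseteq$) of subsets of $|X\otimes X|$; for $g:X\to Y$, $g^*:\Psi Y\to\Psi X$ is $g^*(S)=|g\otimes g|^{-1}(S)$. Abstract equality: $\equiv_X=\langle|\pi_1^X|,|\pi_2^X|\rangle^{-1}(\{(x,x)\mid x\in|X|\})$. The category $\int\Psi$ has objects $(X,R)$ with $R\in\Psi X$ and morphisms $g:(X,R)\to(Y,S)$ the $\mathbf C$-morphisms $g:X\to Y$ with $R\subseteq g^*S$. The equality functor $\mathrm{Eq}:\mathbf C\to\int\Psi$ is $X\mapsto(X,\equiv_X)$, $g\mapsto g$. An indexed morphism $\lambda:\Psi\to\Psi F$ is a family of monotone maps $\lambda_X:\Psi X\to\Psi(FX)$ with $\lambda_X(g^*S)=(Fg)^*(\lambda_YS)$. A coalgebra homomorphism $f:(X,\alpha)\to(Y,\beta)$ is $f:X\to Y$ with $Ff\circ\alpha=\beta\circ f$. A morphism $g:(X,R)\to(Y,S)$ of $\int\Psi$ is Cartesian if $R=g^*S$; the unit of $\mathrm{Qu}\dashv\mathrm{Eq}$ is Cartesian if all its components $(X,R)\to\mathrm{Eq}(\mathrm{Qu}(X,R))$ are Cartesian. *)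

theory Defs
  imports Main "HOL-Library.FuncSet"
begin

section \<open>Categories, functors, adjunctions\<close>

record ('o, 'a) cat =
  Ob :: "'o set"
  Ar :: "'a set"
  Dom :: "'a \<Rightarrow> 'o"
  Cod :: "'a \<Rightarrow> 'o"
  Ide :: "'o \<Rightarrow> 'a"
  Cmp :: "'a \<Rightarrow> 'a \<Rightarrow> 'a"  \<comment> \<open>\<open>Cmp C g f\<close> is \<open>g\<close> after \<open>f\<close>\<close>

definition hom :: "('o, 'a) cat \<Rightarrow> 'o \<Rightarrow> 'o \<Rightarrow> 'a set" where
  "hom C X Y = {f \<in> Ar C. Dom C f = X \<and> Cod C f = Y}"

locale category =
  fixes C :: "('o, 'a) cat"
  assumes Dom_Ob: "f \<in> Ar C \<Longrightarrow> Dom C f \<in> Ob C"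
    and Cod_Ob: "f \<in> Ar C \<Longrightarrow> Cod C f \<in> Ob C"
    and Ide_hom: "X \<in> Ob C \<Longrightarrow> Ide C X \<in> hom C X X"
    and Cmp_hom: "f \<in> hom C X Y \<Longrightarrow> g \<in> hom C Y Z \<Longrightarrow> Cmp C g f \<in> hom C X Z"
    and Cmp_Ide_left: "f \<in> hom C X Y \<Longrightarrow> Cmp C (Ide C Y) f = f"
    and Cmp_Ide_right: "f \<in> hom C X Y \<Longrightarrow> Cmp C f (Ide C X) = f"
    and Cmp_assoc: "f \<in> hom C W X \<Longrightarrow> g \<in> hom C X Y \<Longrightarrow> h \<in> hom C Y Z \<Longrightarrow>
      Cmp C h (Cmp C g f) = Cmp C (Cmp C h g) f"

record ('o, 'a, 'p, 'b) fctr =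
  on_ob :: "'o \<Rightarrow> 'p"
  on_ar :: "'a \<Rightarrow> 'b"

locale is_functor =
  source: category C + target: category D
  for C :: "('o, 'a) cat" and D :: "('p, 'b) cat" +
  fixes F :: "('o, 'a, 'p, 'b) fctr"
  assumes on_ob_Ob: "X \<in> Ob C \<Longrightarrow> on_ob F X \<in> Ob D"
    and on_ar_hom: "f \<in> hom C X Y \<Longrightarrow> on_ar F f \<in> hom D (on_ob F X) (on_ob F Y)"
    and on_ar_Ide: "X \<in> Ob C \<Longrightarrow> on_ar F (Ide C X) = Ide D (on_ob F X)"
    and on_ar_Cmp: "f \<in> hom C X Y \<Longrightarrow> g \<in> hom C Y Z \<Longrightarrow>
      on_ar F (Cmp C g f) = Cmp D (on_ar F g) (on_ar F f)"

definition id_fctr :: "('o, 'a, 'o, 'a) fctr" where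
  "id_fctr = \<lparr>on_ob = id, on_ar = id\<rparr>"

definition comp_fctr ::
  "('p, 'b, 'q, 'c) fctr \<Rightarrow> ('o, 'a, 'p, 'b) fctr \<Rightarrow> ('o, 'a, 'q, 'c) fctr" where
  "comp_fctr G F = \<lparr>on_ob = on_ob G \<circ> on_ob F, on_ar = on_ar G \<circ> on_ar F\<rparr>"

locale nat_trans =
  F: is_functor C D F + G: is_functor C D G
  for C :: "('o, 'a) cat" and D :: "('p, 'b) cat"
    and F G :: "('o, 'a, 'p, 'b) fctr" +
  fixes \<tau> :: "'o \<Rightarrow> 'b"
  assumes component_hom: "X \<in> Ob C \<Longrightarrow> \<tau> X \<in> hom D (on_ob F X) (on_ob G X)"
    and naturality: "f \<in> hom C X Y \<Longrightarrow>
      Cmp D (on_ar G f) (\<tau> X) = Cmp D (\<tau> Y) (on_ar F f)"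

text \<open>\<open>L : A \<rightarrow> B\<close> is left adjoint to \<open>R : B \<rightarrow> A\<close> with unit \<open>\<eta>\<close> and counit \<open>\<epsilon>\<close>.\<close>

locale adjunction =
  L: is_functor A B L + R: is_functor B A R +
  unit: nat_trans A A id_fctr "comp_fctr R L" \<eta> +
  counit: nat_trans B B "comp_fctr L R" id_fctr \<epsilon>
  for A :: "('o, 'a) cat" and B :: "('p, 'b) cat"
    and L :: "('o, 'a, 'p, 'b) fctr" and R :: "('p, 'b, 'o, 'a) fctr"
    and \<eta> :: "'o \<Rightarrow> 'a" and \<epsilon> :: "'p \<Rightarrow> 'b" +
  assumes triangle_left: "X \<in> Ob A \<Longrightarrow>
      Cmp B (\<epsilon> (on_ob L X)) (on_ar L (\<eta> X)) = Ide B (on_ob L X)"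
    and triangle_right: "Y \<in> Ob B \<Longrightarrow>
      Cmp A (on_ar R (\<epsilon> Y)) (\<eta> (on_ob R Y)) = Ide A (on_ob R Y)"

section \<open>Binary products\<close>

record ('o, 'a) prods =
  Otimes :: "'o \<Rightarrow> 'o \<Rightarrow> 'o"
  Proj1 :: "'o \<Rightarrow> 'o \<Rightarrow> 'a"
  Proj2 :: "'o \<Rightarrow> 'o \<Rightarrow> 'a"

locale binary_products = category C
  for C :: "('o, 'a) cat" +
  fixes P :: "('o, 'a) prods"
  assumes Otimes_Ob: "X \<in> Ob C \<Longrightarrow> Y \<in> Ob C \<Longrightarrow> Otimes P X Y \<in> Ob C"
    and Proj1_hom: "X \<in> Ob C \<Longrightarrow> Y \<in> Ob C \<Longrightarrow> Proj1 P X Y \<in> hom C (Otimes P X Y) X"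
    and Proj2_hom: "X \<in> Ob C \<Longrightarrow> Y \<in> Ob C \<Longrightarrow> Proj2 P X Y \<in> hom C (Otimes P X Y) Y"
    and universal: "f \<in> hom C Z X \<Longrightarrow> g \<in> hom C Z Y \<Longrightarrow>
      \<exists>!h. h \<in> hom C Z (Otimes P X Y) \<and>
        Cmp C (Proj1 P X Y) h = f \<and> Cmp C (Proj2 P X Y) h = g"

definition tensor :: "('o, 'a) cat \<Rightarrow> ('o, 'a) prods \<Rightarrow> 'a \<Rightarrow> 'a" where
  "tensor C P g = (let X = Dom C g; Y = Cod C g in
     THE h. h \<in> hom C (Otimes P X X) (Otimes P Y Y) \<and>
       Cmp C (Proj1 P Y Y) h = Cmp C g (Proj1 P X X) \<and>
       Cmp C (Proj2 P Y Y) h = Cmp C g (Proj2 P X X))"  \<comment> \<open>\<open>g \<otimes> g\<close>\<close>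

section \<open>The category of sets\<close>

text \<open>The category of all subsets of a type \<open>'u\<close>. An arrow is a function together with
  its domain and codomain; the function is \<open>undefined\<close> off the domain, so that arrows are
  equal iff they agree as set-theoretic functions.\<close>

type_synonym 'u fn = "'u set \<times> ('u \<Rightarrow> 'u) \<times> 'u set"

definition Set_cat :: "('u set, 'u fn) cat" where
  "Set_cat = \<lparr>
     Ob = UNIV,
     Ar = {(A, f, B). f \<in> A \<rightarrow>\<^sub>E B},
     Dom = (\<lambda>(A, f, B). A),
     Cod = (\<lambda>(A, f, B). B),
     Ide = (\<lambda>A. (A, \<lambda>x\<in>A. x, A)),
     Cmp = (\<lambda>(B, g, D) (A, f, B'). (A, compose A g f, D))\<rparr>"

definition fn_app :: "'u fn \<Rightarrow> 'u \<Rightarrow> 'u" where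
  "fn_app m = fst (snd m)"

section \<open>The indexed poset \<open>\<Psi>\<close> and its category of elements\<close>

definition Psi ::
  "('o, 'a, 'u set, 'u fn) fctr \<Rightarrow> ('o, 'a) prods \<Rightarrow> 'o \<Rightarrow> 'u set set" where
  "Psi U P X = Pow (on_ob U (Otimes P X X))"

definition reindex ::
  "('o, 'a) cat \<Rightarrow> ('o, 'a, 'u set, 'u fn) fctr \<Rightarrow> ('o, 'a) prods \<Rightarrow> 'a \<Rightarrow> 'u set \<Rightarrow> 'u set" where
  "reindex C U P g S =
     {z \<in> on_ob U (Otimes P (Dom C g) (Dom C g)). fn_app (on_ar U (tensor C P g)) z \<in> S}"

definition abs_eq ::
  "('o, 'a, 'u set, 'u fn) fctr \<Rightarrow> ('o, 'a) prods \<Rightarrow> 'o \<Rightarrow> 'u set" where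
  "abs_eq U P X =
     {z \<in> on_ob U (Otimes P X X).
        (fn_app (on_ar U (Proj1 P X X)) z, fn_app (on_ar U (Proj2 P X X)) z)
          \<in> {(x, x) | x. x \<in> on_ob U X}}"

text \<open>The same \<open>C\<close>-arrow may underlie many arrows of \<open>\<integral>\<Psi>\<close>, so the latter carry their
  source and target.\<close>

type_synonym ('o, 'a, 'u) int_ar = "('o \<times> 'u set) \<times> 'a \<times> ('o \<times> 'u set)"

definition int_Psi ::
  "('o, 'a) cat \<Rightarrow> ('o, 'a, 'u set, 'u fn) fctr \<Rightarrow> ('o, 'a) prods
    \<Rightarrow> ('o \<times> 'u set, ('o, 'a, 'u) int_ar) cat" where
  "int_Psi C U P = \<lparr>
     Ob = {(X, R). X \<in> Ob C \<and> R \<in> Psi U P X},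
     Ar = {((X, R), g, (Y, S)). R \<in> Psi U P X \<and> S \<in> Psi U P Y \<and>
            g \<in> hom C X Y \<and> R \<subseteq> reindex C U P g S},
     Dom = (\<lambda>(A, g, B). A),
     Cod = (\<lambda>(A, g, B). B),
     Ide = (\<lambda>(X, R). ((X, R), Ide C X, (X, R))),
     Cmp = (\<lambda>(B, g, D) (A, f, B'). (A, Cmp C g f, D))\<rparr>"

definition Eq_fctr ::
  "('o, 'a) cat \<Rightarrow> ('o, 'a, 'u set, 'u fn) fctr \<Rightarrow> ('o, 'a) prods
    \<Rightarrow> ('o, 'a, 'o \<times> 'u set, ('o, 'a, 'u) int_ar) fctr" where
  "Eq_fctr C U P = \<lparr>
     on_ob = (\<lambda>X. (X, abs_eq U P X)),
     on_ar = (\<lambda>g. ((Dom C g, abs_eq U P (Dom C g)), g, (Cod C g, abs_eq U P (Cod C g))))\<rparr>"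

definition cartesian ::
  "('o, 'a) cat \<Rightarrow> ('o, 'a, 'u set, 'u fn) fctr \<Rightarrow> ('o, 'a) prods
    \<Rightarrow> ('o, 'a, 'u) int_ar \<Rightarrow> bool" where
  "cartesian C U P m \<longleftrightarrow> (case m of ((X, R), g, (Y, S)) \<Rightarrow> R = reindex C U P g S)"

definition indexed_morphism ::
  "('o, 'a) cat \<Rightarrow> ('o, 'a, 'u set, 'u fn) fctr \<Rightarrow> ('o, 'a) prods
    \<Rightarrow> ('o, 'a, 'o, 'a) fctr \<Rightarrow> ('o \<Rightarrow> 'u set \<Rightarrow> 'u set) \<Rightarrow> bool" where
  "indexed_morphism C U P F lam \<longleftrightarrow>
     (\<forall>X \<in> Ob C. lam X \<in> Psi U P X \<rightarrow> Psi U P (on_ob F X) \<and> mono_on (Psi U P X) (lam X)) \<and>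
     (\<forall>X Y g S. g \<in> hom C X Y \<longrightarrow> S \<in> Psi U P Y \<longrightarrow>
        lam X (reindex C U P g S) = reindex C U P (on_ar F g) (lam Y S))"

section \<open>Coalgebras\<close>

definition coalgebra :: "('o, 'a) cat \<Rightarrow> ('o, 'a, 'o, 'a) fctr \<Rightarrow> 'o \<Rightarrow> 'a \<Rightarrow> bool" where
  "coalgebra C F X \<alpha> \<longleftrightarrow> X \<in> Ob C \<and> \<alpha> \<in> hom C X (on_ob F X)"

definition coalgebra_hom ::
  "('o, 'a) cat \<Rightarrow> ('o, 'a, 'o, 'a) fctr \<Rightarrow> 'o \<Rightarrow> 'a \<Rightarrow> 'o \<Rightarrow> 'a \<Rightarrow> 'a \<Rightarrow> bool" where
  "coalgebra_hom C F X \<alpha> Y \<beta> f \<longleftrightarrow>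
     f \<in> hom C X Y \<and> Cmp C (on_ar F f) \<alpha> = Cmp C \<beta> f"

section \<open>Well-definedness\<close>

lemma Set_hom_iff: "m \<in> hom Set_cat A B \<longleftrightarrow> (\<exists>f. m = (A, f, B) \<and> f \<in> A \<rightarrow>\<^sub>E B)"
  by (auto simp: hom_def Set_cat_def)

lemma Set_Cmp: "Cmp Set_cat (B, g, D) (A, f, B') = (A, compose A g f, D)"
  by (simp add: Set_cat_def)

lemma compose_PiE: "f \<in> A \<rightarrow>\<^sub>E B \<Longrightarrow> g \<in> B \<rightarrow>\<^sub>E D \<Longrightarrow> compose A g f \<in> A \<rightarrow>\<^sub>E D"
  by (auto simp: compose_def)

lemma category_Set_cat: "category (Set_cat :: ('u set, 'u fn) cat)"
proof
  show "Dom Set_cat f \<in> Ob Set_cat" for f :: "'u fn" by (simp add: Set_cat_def)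
  show "Cod Set_cat f \<in> Ob Set_cat" for f :: "'u fn" by (simp add: Set_cat_def)
  show "Ide Set_cat A \<in> hom Set_cat A A" for A :: "'u set"
    unfolding Set_hom_iff by (simp add: Set_cat_def)
  show "Cmp Set_cat g f \<in> hom Set_cat A D"
    if f: "f \<in> hom Set_cat A B" and g: "g \<in> hom Set_cat B D" for f g :: "'u fn" and A B D
  proof -
    obtain f' g' where e: "f = (A, f', B)" "g = (B, g', D)"
      and f': "f' \<in> A \<rightarrow>\<^sub>E B" and g': "g' \<in> B \<rightarrow>\<^sub>E D"
      using f g unfolding Set_hom_iff by blast
    show ?thesis using compose_PiE[OF f' g'] unfolding e Set_Cmp Set_hom_iff by blast
  qed
  show "Cmp Set_cat (Ide Set_cat B) f = f" if f: "f \<in> hom Set_cat A B" for f :: "'u fn" and A B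
  proof -
    obtain f' where f': "f = (A, f', B)" "f' \<in> A \<rightarrow>\<^sub>E B" using f unfolding Set_hom_iff by blast
    have "compose A (\<lambda>x\<in>B. x) f' = f'"
      using f'(2) by (intro Id_compose) (auto simp: PiE_def)
    then show ?thesis by (simp add: f'(1) Set_cat_def)
  qed
  show "Cmp Set_cat f (Ide Set_cat A) = f" if f: "f \<in> hom Set_cat A B" for f :: "'u fn" and A B
  proof -
    obtain f' where f': "f = (A, f', B)" "f' \<in> A \<rightarrow>\<^sub>E B" using f unfolding Set_hom_iff by blast
    have "compose A f' (\<lambda>x\<in>A. x) = f'"
      using f'(2) by (intro compose_Id) (auto simp: PiE_def)
    then show ?thesis by (simp add: f'(1) Set_cat_def)
  qed
  show "Cmp Set_cat h (Cmp Set_cat g f) = Cmp Set_cat (Cmp Set_cat h g) f"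
    if f: "f \<in> hom Set_cat A B" and g: "g \<in> hom Set_cat B D" and h: "h \<in> hom Set_cat D E"
    for f g h :: "'u fn" and A B D E
  proof -
    obtain f' g' h' where e: "f = (A, f', B)" "g = (B, g', D)" "h = (D, h', E)"
      and f': "f' \<in> A \<rightarrow>\<^sub>E B"
      using f g h unfolding Set_hom_iff by blast
    have "f' \<in> A \<rightarrow> B" using f' by (simp add: PiE_def)
    then show ?thesis
      unfolding e Set_Cmp by (simp add: compose_assoc)
  qed
qed

locale psi_setting =
  binary_products C P + U: is_functor C Set_cat U
  for C :: "('o, 'a) cat" and U :: "('o, 'a, 'u set, 'u fn) fctr" and P :: "('o, 'a) prods"
begin

lemma hom_Ob: "f \<in> hom C X Y \<Longrightarrow> X \<in> Ob C \<and> Y \<in> Ob C"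
  using Dom_Ob Cod_Ob by (auto simp: hom_def)

lemma tensor:
  assumes g: "g \<in> hom C X Y"
  shows "tensor C P g \<in> hom C (Otimes P X X) (Otimes P Y Y)"
    and "Cmp C (Proj1 P Y Y) (tensor C P g) = Cmp C g (Proj1 P X X)"
    and "Cmp C (Proj2 P Y Y) (tensor C P g) = Cmp C g (Proj2 P X X)"
proof -
  have X: "X \<in> Ob C" using hom_Ob[OF g] by blast
  have d: "Dom C g = X" "Cod C g = Y" using g by (auto simp: hom_def)
  note u = theI'[OF universal[OF Cmp_hom[OF Proj1_hom[OF X X] g] Cmp_hom[OF Proj2_hom[OF X X] g]]]
  show "tensor C P g \<in> hom C (Otimes P X X) (Otimes P Y Y)"
    and "Cmp C (Proj1 P Y Y) (tensor C P g) = Cmp C g (Proj1 P X X)"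
    and "Cmp C (Proj2 P Y Y) (tensor C P g) = Cmp C g (Proj2 P X X)"
    using u unfolding tensor_def Let_def d by blast+
qed

lemma tensor_unique:
  assumes g: "g \<in> hom C X Y" and h: "h \<in> hom C (Otimes P X X) (Otimes P Y Y)"
    "Cmp C (Proj1 P Y Y) h = Cmp C g (Proj1 P X X)"
    "Cmp C (Proj2 P Y Y) h = Cmp C g (Proj2 P X X)"
  shows "tensor C P g = h"
proof -
  have X: "X \<in> Ob C" using hom_Ob[OF g] by blast
  show ?thesis
    using universal[OF Cmp_hom[OF Proj1_hom[OF X X] g] Cmp_hom[OF Proj2_hom[OF X X] g]]
      tensor[OF g] h by blast
qed

lemma tensor_Ide:
  assumes X: "X \<in> Ob C"
  shows "tensor C P (Ide C X) = Ide C (Otimes P X X)"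
  using tensor_unique[OF Ide_hom[OF X] Ide_hom[OF Otimes_Ob[OF X X]]]
    Cmp_Ide_left Cmp_Ide_right Proj1_hom[OF X X] Proj2_hom[OF X X] by metis

lemma tensor_Cmp:
  assumes f: "f \<in> hom C X Y" and g: "g \<in> hom C Y Z"
  shows "tensor C P (Cmp C g f) = Cmp C (tensor C P g) (tensor C P f)"
proof (rule tensor_unique[OF Cmp_hom[OF f g] Cmp_hom[OF tensor(1)[OF f] tensor(1)[OF g]]])
  have X: "X \<in> Ob C" and Y: "Y \<in> Ob C" and Z: "Z \<in> Ob C"
    using hom_Ob[OF f] hom_Ob[OF g] by auto
  show "Cmp C (Proj1 P Z Z) (Cmp C (tensor C P g) (tensor C P f)) = Cmp C (Cmp C g f) (Proj1 P X X)"
    using Cmp_assoc[OF tensor(1)[OF f] tensor(1)[OF g] Proj1_hom[OF Z Z]] tensor(2)[OF g]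
      Cmp_assoc[OF tensor(1)[OF f] Proj1_hom[OF Y Y] g] tensor(2)[OF f]
      Cmp_assoc[OF Proj1_hom[OF X X] f g] by simp
  show "Cmp C (Proj2 P Z Z) (Cmp C (tensor C P g) (tensor C P f)) = Cmp C (Cmp C g f) (Proj2 P X X)"
    using Cmp_assoc[OF tensor(1)[OF f] tensor(1)[OF g] Proj2_hom[OF Z Z]] tensor(3)[OF g]
      Cmp_assoc[OF tensor(1)[OF f] Proj2_hom[OF Y Y] g] tensor(3)[OF f]
      Cmp_assoc[OF Proj2_hom[OF X X] f g] by simp
qed

lemma app_in: "f \<in> hom C X Y \<Longrightarrow> z \<in> on_ob U X \<Longrightarrow> fn_app (on_ar U f) z \<in> on_ob U Y"
  using U.on_ar_hom[of f X Y] by (auto simp: Set_cat_def hom_def fn_app_def)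

lemma app_Ide: "X \<in> Ob C \<Longrightarrow> z \<in> on_ob U X \<Longrightarrow> fn_app (on_ar U (Ide C X)) z = z"
  using U.on_ar_Ide[of X] by (auto simp: Set_cat_def fn_app_def)

lemma app_Cmp:
  "f \<in> hom C X Y \<Longrightarrow> g \<in> hom C Y Z \<Longrightarrow> z \<in> on_ob U X \<Longrightarrow>
    fn_app (on_ar U (Cmp C g f)) z = fn_app (on_ar U g) (fn_app (on_ar U f) z)"
  using U.on_ar_hom[of f X Y] U.on_ar_hom[of g Y Z] U.on_ar_Cmp[of f X Y g Z]
  by (auto simp: Set_cat_def hom_def fn_app_def compose_def)

lemma reindex_iff:
  "g \<in> hom C X Y \<Longrightarrow> z \<in> reindex C U P g S \<longleftrightarrow>
    z \<in> on_ob U (Otimes P X X) \<and> fn_app (on_ar U (tensor C P g)) z \<in> S"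
  by (auto simp: reindex_def hom_def)

lemma reindex_Psi: "g \<in> hom C X Y \<Longrightarrow> reindex C U P g S \<in> Psi U P X"
  by (auto simp: Psi_def reindex_iff)

lemma reindex_Ide:
  assumes X: "X \<in> Ob C" and R: "R \<in> Psi U P X"
  shows "reindex C U P (Ide C X) R = R"
  using R app_Ide[OF Otimes_Ob[OF X X]]
  by (auto simp: reindex_iff[OF Ide_hom[OF X]] tensor_Ide[OF X] Psi_def)

lemma reindex_Cmp:
  assumes f: "f \<in> hom C X Y" and g: "g \<in> hom C Y Z"
  shows "reindex C U P (Cmp C g f) S = reindex C U P f (reindex C U P g S)"
  using app_Cmp[OF tensor(1)[OF f] tensor(1)[OF g]] app_in[OF tensor(1)[OF f]]
  by (auto simp: reindex_iff[OF Cmp_hom[OF f g]] reindex_iff[OF f] reindex_iff[OF g]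
      tensor_Cmp[OF f g])

lemma reindex_mono: "S \<subseteq> T \<Longrightarrow> reindex C U P g S \<subseteq> reindex C U P g T"
  by (auto simp: reindex_def)

lemma abs_eq_Psi: "abs_eq U P X \<in> Psi U P X"
  by (auto simp: abs_eq_def Psi_def)

lemma abs_eq_reindex:
  assumes g: "g \<in> hom C X Y"
  shows "abs_eq U P X \<subseteq> reindex C U P g (abs_eq U P Y)"
proof
  fix z assume "z \<in> abs_eq U P X"
  then have z: "z \<in> on_ob U (Otimes P X X)"
    and e: "fn_app (on_ar U (Proj1 P X X)) z = fn_app (on_ar U (Proj2 P X X)) z"
    by (auto simp: abs_eq_def)
  have X: "X \<in> Ob C" and Y: "Y \<in> Ob C" using hom_Ob[OF g] by auto
  let ?w = "fn_app (on_ar U (tensor C P g)) z"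
  have w: "?w \<in> on_ob U (Otimes P Y Y)" using app_in[OF tensor(1)[OF g] z] .
  have "fn_app (on_ar U (Proj1 P Y Y)) ?w = fn_app (on_ar U g) (fn_app (on_ar U (Proj1 P X X)) z)"
    using app_Cmp[OF tensor(1)[OF g] Proj1_hom[OF Y Y] z] tensor(2)[OF g]
      app_Cmp[OF Proj1_hom[OF X X] g z] by simp
  moreover have "fn_app (on_ar U (Proj2 P Y Y)) ?w
      = fn_app (on_ar U g) (fn_app (on_ar U (Proj2 P X X)) z)"
    using app_Cmp[OF tensor(1)[OF g] Proj2_hom[OF Y Y] z] tensor(3)[OF g]
      app_Cmp[OF Proj2_hom[OF X X] g z] by simp
  ultimately show "z \<in> reindex C U P g (abs_eq U P Y)"
    using z w e app_in[OF Proj1_hom[OF Y Y] w] by (auto simp: reindex_iff[OF g] abs_eq_def)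
qed

lemma int_hom_iff:
  "m \<in> hom (int_Psi C U P) (X, R) (Y, S) \<longleftrightarrow>
    (\<exists>g. m = ((X, R), g, (Y, S)) \<and> R \<in> Psi U P X \<and> S \<in> Psi U P Y \<and>
      g \<in> hom C X Y \<and> R \<subseteq> reindex C U P g S)"
  by (auto simp: hom_def int_Psi_def)

lemma category_int_Psi: "category (int_Psi C U P)"
proof
  let ?I = "int_Psi C U P"
  show "Dom ?I f \<in> Ob ?I" if "f \<in> Ar ?I" for f
    using that hom_Ob by (auto simp: int_Psi_def)
  show "Cod ?I f \<in> Ob ?I" if "f \<in> Ar ?I" for f
    using that hom_Ob by (auto simp: int_Psi_def)
  show "Ide ?I A \<in> hom ?I A A" if "A \<in> Ob ?I" for A
    using that by (cases A) (auto simp: int_hom_iff, auto simp: int_Psi_def reindex_Ide Ide_hom)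
  show "Cmp ?I g f \<in> hom ?I A D" if f: "f \<in> hom ?I A B" and g: "g \<in> hom ?I B D" for f g A B D
  proof -
    obtain X R Y S Z T where A: "A = (X, R)" "B = (Y, S)" "D = (Z, T)"
      by (metis surj_pair)
    obtain f' g' where f': "f = (A, f', B)" "f' \<in> hom C X Y" "R \<subseteq> reindex C U P f' S"
      and g': "g = (B, g', D)" "g' \<in> hom C Y Z" "S \<subseteq> reindex C U P g' T"
      and R: "R \<in> Psi U P X" "T \<in> Psi U P Z"
      using f g unfolding A int_hom_iff by blast
    have "R \<subseteq> reindex C U P (Cmp C g' f') T"
      using reindex_Cmp[OF f'(2) g'(2)] reindex_mono[OF g'(3)] f'(3) by blast
    moreover have "Cmp ?I g f = (A, Cmp C g' f', D)" by (simp add: f' g' int_Psi_def)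
    ultimately show ?thesis using R Cmp_hom[OF f'(2) g'(2)] unfolding A int_hom_iff by blast
  qed
  show "Cmp ?I (Ide ?I B) f = f" if "f \<in> hom ?I A B" for f A B
    using that by (cases A, cases B) (auto simp: int_hom_iff, auto simp: int_Psi_def Cmp_Ide_left)
  show "Cmp ?I f (Ide ?I A) = f" if "f \<in> hom ?I A B" for f A B
    using that by (cases A, cases B) (auto simp: int_hom_iff, auto simp: int_Psi_def Cmp_Ide_right)
  show "Cmp ?I h (Cmp ?I g f) = Cmp ?I (Cmp ?I h g) f"
    if "f \<in> hom ?I A B" "g \<in> hom ?I B D" "h \<in> hom ?I D E" for f g h A B D E
    using that by (cases A, cases B, cases D, cases E)
      (auto simp: int_hom_iff, auto simp: int_Psi_def Cmp_assoc)
qed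

lemma is_functor_Eq_fctr: "is_functor C (int_Psi C U P) (Eq_fctr C U P)"
proof -
  interpret I: category "int_Psi C U P" by (rule category_int_Psi)
  let ?I = "int_Psi C U P" and ?E = "Eq_fctr C U P"
  show ?thesis
  proof
    show "on_ob ?E X \<in> Ob ?I" if "X \<in> Ob C" for X
      using that abs_eq_Psi by (auto simp: Eq_fctr_def int_Psi_def)
    show "on_ar ?E f \<in> hom ?I (on_ob ?E X) (on_ob ?E Y)" if "f \<in> hom C X Y" for f X Y
      using that abs_eq_Psi abs_eq_reindex[OF that]
      by (auto simp: Eq_fctr_def int_Psi_def hom_def)
    show "on_ar ?E (Ide C X) = Ide ?I (on_ob ?E X)" if "X \<in> Ob C" for X
      using Ide_hom[OF that] by (auto simp: Eq_fctr_def int_Psi_def hom_def)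
    show "on_ar ?E (Cmp C g f) = Cmp ?I (on_ar ?E g) (on_ar ?E f)"
      if "f \<in> hom C X Y" "g \<in> hom C Y Z" for f g X Y Z
      using that Cmp_hom[OF that] by (auto simp: Eq_fctr_def int_Psi_def hom_def)
  qed
qed

end

end

theory Submission imports Defs begin

text \<open>
  Let \<open>f : (X, R) \<rightarrow> Eq Y\<close> with \<open>Y = Qu (X, R)\<close> be the unit. Applying \<open>\<lambda>\<close> to \<open>R \<subseteq> f\<^sup>*(\<equiv>\<^sub>Y)\<close> and
  using that \<open>\<lambda>\<close> preserves abstract equality, the invariance of \<open>R\<close> makes \<open>F f \<circ> \<alpha>\<close> a morphism
  \<open>(X, R) \<rightarrow> Eq (F Y)\<close>. By the universal property of the unit it factors through \<open>f\<close>, and the factor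
  is the coalgebra structure on \<open>Y\<close>.
\<close>

text \<open>The factor is the adjoint transpose of \<open>m\<close>, namely
  \<open>\<epsilon> y\<close> after \<open>on_ar L m\<close>: naturality of the unit moves
  \<open>\<eta>\<close> past \<open>m\<close>, and a triangle identity then cancels it against the
  counit.\<close>

lemma (in adjunction) unit_factorization:
  assumes x: "x \<in> Ob A" and y: "y \<in> Ob B" and m: "m \<in> hom A x (on_ob R y)"
  shows "\<exists>h \<in> hom B (on_ob L x) y. Cmp A (on_ar R h) (\<eta> x) = m"
proof
  let ?h = "Cmp B (\<epsilon> y) (on_ar L m)"
  have Lm: "on_ar L m \<in> hom B (on_ob L x) (on_ob L (on_ob R y))"
    by (rule L.on_ar_hom[OF m])
  have eps: "\<epsilon> y \<in> hom B (on_ob L (on_ob R y)) y"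
    using counit.component_hom[OF y] by (simp add: comp_fctr_def id_fctr_def)
  have eta: "\<eta> x \<in> hom A x (on_ob R (on_ob L x))"
    using unit.component_hom[OF x] by (simp add: comp_fctr_def id_fctr_def)
  have etaR: "\<eta> (on_ob R y) \<in> hom A (on_ob R y) (on_ob R (on_ob L (on_ob R y)))"
    using unit.component_hom[OF R.on_ob_Ob[OF y]] by (simp add: comp_fctr_def id_fctr_def)
  show "?h \<in> hom B (on_ob L x) y"
    by (rule L.target.Cmp_hom[OF Lm eps])
  have "Cmp A (on_ar R ?h) (\<eta> x) = Cmp A (on_ar R (\<epsilon> y)) (Cmp A (on_ar R (on_ar L m)) (\<eta> x))"
    by (simp add: R.on_ar_Cmp[OF Lm eps]
        L.source.Cmp_assoc[OF eta R.on_ar_hom[OF Lm] R.on_ar_hom[OF eps]])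
  also have "Cmp A (on_ar R (on_ar L m)) (\<eta> x) = Cmp A (\<eta> (on_ob R y)) m"
    using unit.naturality[OF m] by (simp add: comp_fctr_def id_fctr_def)
  also have "Cmp A (on_ar R (\<epsilon> y)) (Cmp A (\<eta> (on_ob R y)) m) = m"
    by (simp add: L.source.Cmp_assoc[OF m etaR R.on_ar_hom[OF eps]] triangle_right[OF y]
        L.source.Cmp_Ide_left[OF m])
  finally show "Cmp A (on_ar R ?h) (\<eta> x) = m" .
qed

text \<open>Supplies the arrow to be factored through the unit. It holds for every \<open>f\<close>
  out of \<open>X\<close> that sends \<open>R\<close> into abstract equality, so the adjunction
  enters only later.\<close>

lemma (in psi_setting) invariant_comp_reindex_abs_eq:
  assumes F: "is_functor C C F"
    and lam: "indexed_morphism C U P F lam"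
    and lam_eq: "\<forall>X \<in> Ob C. lam X (abs_eq U P X) = abs_eq U P (on_ob F X)"
    and \<alpha>: "\<alpha> \<in> hom C X (on_ob F X)"
    and R: "R \<in> Psi U P X" and inv: "R \<subseteq> reindex C U P \<alpha> (lam X R)"
    and f: "f \<in> hom C X Y" and Rf: "R \<subseteq> reindex C U P f (abs_eq U P Y)"
  shows "R \<subseteq> reindex C U P (Cmp C (on_ar F f) \<alpha>) (abs_eq U P (on_ob F Y))"
proof -
  interpret F: is_functor C C F by (rule F)
  have X: "X \<in> Ob C" and Y: "Y \<in> Ob C" using hom_Ob[OF f] by auto
  have "lam X R \<subseteq> lam X (reindex C U P f (abs_eq U P Y))"
    using lam X R reindex_Psi[OF f] Rf unfolding indexed_morphism_def
    by (blast dest: mono_onD)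
  \<comment> \<open>Compatibility of \<open>lam\<close> with reindexing replaces \<open>f\<close> by
    \<open>on_ar F f\<close>; then \<open>lam\<close> acts on abstract equality itself, which it
    preserves.\<close>
  also have "\<dots> = reindex C U P (on_ar F f) (abs_eq U P (on_ob F Y))"
    using lam f abs_eq_Psi lam_eq Y unfolding indexed_morphism_def by metis
  finally have "R \<subseteq> reindex C U P \<alpha> (reindex C U P (on_ar F f) (abs_eq U P (on_ob F Y)))"
    using inv reindex_mono by blast
  then show ?thesis
    by (simp add: reindex_Cmp[OF \<alpha> F.on_ar_hom[OF f]])
qed

theorem theorem2:
  fixes C :: "('o, 'a) cat"
    and U :: "('o, 'a, 'u set, 'u fn) fctr"
    and P :: "('o, 'a) prods"
    and F :: "('o, 'a, 'o, 'a) fctr"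
    and lam :: "'o \<Rightarrow> 'u set \<Rightarrow> 'u set"
    and Qu :: "('o \<times> 'u set, ('o, 'a, 'u) int_ar, 'o, 'a) fctr"
    and \<eta> :: "'o \<times> 'u set \<Rightarrow> ('o, 'a, 'u) int_ar"
    and \<epsilon> :: "'o \<Rightarrow> 'a"
    and X :: 'o and \<alpha> :: 'a and R :: "'u set"
  assumes "category C"
    and "is_functor C Set_cat U"
    and "binary_products C P"
    and "is_functor C C F"
    and "indexed_morphism C U P F lam"
    and "\<forall>X \<in> Ob C. lam X (abs_eq U P X) = abs_eq U P (on_ob F X)"
    and "adjunction (int_Psi C U P) C Qu (Eq_fctr C U P) \<eta> \<epsilon>"
    and "coalgebra C F X \<alpha>"
    and "R \<in> Psi U P X"
    and "R \<subseteq> reindex C U P \<alpha> (lam X R)"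
  shows "\<exists>Y \<beta> f. coalgebra C F Y \<beta> \<and> coalgebra_hom C F X \<alpha> Y \<beta> f \<and>
           R \<subseteq> reindex C U P f (abs_eq U P Y) \<and>
           ((\<forall>A \<in> Ob (int_Psi C U P). cartesian C U P (\<eta> A)) \<longrightarrow>
              R = reindex C U P f (abs_eq U P Y))"
proof -
  interpret psi_setting C U P
    using assms(2,3) by (simp add: psi_setting_def)
  interpret F: is_functor C C F by (rule assms(4))
  interpret adj: adjunction "int_Psi C U P" C Qu "Eq_fctr C U P" \<eta> \<epsilon> by (rule assms(7))
  have X: "X \<in> Ob C" and \<alpha>: "\<alpha> \<in> hom C X (on_ob F X)"
    using assms(8) by (auto simp: coalgebra_def)
  have A: "(X, R) \<in> Ob (int_Psi C U P)"
    using X assms(9) by (simp add: int_Psi_def)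
  define Y where "Y = on_ob Qu (X, R)"
  have Y: "Y \<in> Ob C" using adj.L.on_ob_Ob[OF A] by (simp add: Y_def)
  have "\<eta> (X, R) \<in> hom (int_Psi C U P) (X, R) (Y, abs_eq U P Y)"
    using adj.unit.component_hom[OF A]
    by (simp add: comp_fctr_def id_fctr_def Eq_fctr_def Y_def)
  then obtain f where eta: "\<eta> (X, R) = ((X, R), f, (Y, abs_eq U P Y))"
    and f: "f \<in> hom C X Y" and Rf: "R \<subseteq> reindex C U P f (abs_eq U P Y)"
    unfolding int_hom_iff by blast
  \<comment> \<open>The target of \<open>?m\<close> is Eq of \<open>on_ob F Y\<close>, so its factor
    through the unit runs from \<open>Y\<close> to \<open>on_ob F Y\<close>, as a coalgebra
    structure must.\<close>
  let ?g = "Cmp C (on_ar F f) \<alpha>"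
  let ?m = "((X, R), ?g, (on_ob F Y, abs_eq U P (on_ob F Y)))"
  have "?m \<in> hom (int_Psi C U P) (X, R) (on_ob (Eq_fctr C U P) (on_ob F Y))"
    using invariant_comp_reindex_abs_eq[OF assms(4,5,6) \<alpha> assms(9,10) f Rf]
      Cmp_hom[OF \<alpha> F.on_ar_hom[OF f]] assms(9) abs_eq_Psi
    by (simp add: Eq_fctr_def int_hom_iff)
  from adj.unit_factorization[OF A F.on_ob_Ob[OF Y] this]
  obtain \<beta> where \<beta>: "\<beta> \<in> hom C Y (on_ob F Y)"
    and "Cmp (int_Psi C U P) (on_ar (Eq_fctr C U P) \<beta>) (\<eta> (X, R)) = ?m"
    unfolding Y_def by blast
  \<comment> \<open>Comparing the underlying \<open>C\<close>-arrows of the two triples turns the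
    factorization into the homomorphism square.\<close>
  then have "?g = Cmp C \<beta> f"
    by (simp add: eta Eq_fctr_def int_Psi_def)
  then have "coalgebra C F Y \<beta>" "coalgebra_hom C F X \<alpha> Y \<beta> f"
    using Y \<beta> f by (auto simp: coalgebra_def coalgebra_hom_def)
  \<comment> \<open>The unit at \<open>(X, R)\<close> has underlying arrow \<open>f\<close> and
    target Eq of \<open>Y\<close>, so its being Cartesian is exactly this equation.\<close>
  moreover have "R = reindex C U P f (abs_eq U P Y)"
    if "\<forall>A \<in> Ob (int_Psi C U P). cartesian C U P (\<eta> A)"
    using bspec[OF that A] by (simp add: eta cartesian_def)
  ultimately show ?thesis using Rf by blast
qed

end
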